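(* Let $\alpha$ and $\beta$ be $2$-dimensional complex representations of $\Gamma=\mathrm{SL}_2(\mathbf{Z})$. Then $\alpha\otimes\beta$ is irreducible if and only if $\alpha$ and $\beta$ are both irreducible and one of the following holds: (1) exactly one of $\alpha$, $\beta$ is $T$-regular; (2) all three of $\alpha$, $\beta$ and $\alpha\otimes\beta$ are $T$-regular.
   Context: $T=\begin{pmatrix}1&1\\0&1\end{pmatrix}$. A representation $\rho$ of $\Gamma$ is called $T$-regular if the eigenvalues of $\rho(T)$ are pairwise distinct. *)

theory Defs
  imports
    "HOL-Analysis.Analysis"
    "HOL-Algebra.Group"
    "HOL-Computational_Algebra.Polynomial"
begin

definition SL2Z :: "(int^2^2) monoid" where
  "SL2Z = \<lparr>carrier = {A. det A = 1}, mult = (**), one = mat 1\<rparr>"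

definition GL :: "('a::field^'n^'n) monoid" where
  "GL = \<lparr>carrier = {A. invertible A}, mult = (**), one = mat 1\<rparr>"

definition T_mat :: "int^2^2" where
  "T_mat = vector [vector [1, 1], vector [0, 1]]"

text \<open>A complex representation of dimension \<open>CARD('n)\<close> is a homomorphism into
  \<open>GL\<close>, acting on column vectors. Only its values on \<open>carrier G\<close> are relevant.\<close>

definition is_rep :: "('g, 'm) monoid_scheme \<Rightarrow> ('g \<Rightarrow> complex^'n^'n) \<Rightarrow> bool" where
  "is_rep G \<rho> \<longleftrightarrow> \<rho> \<in> hom G GL"

text \<open>The underlying space is never zero, since \<open>'n\<close> is nonempty.\<close>

definition irreducible_rep :: "('g, 'm) monoid_scheme \<Rightarrow> ('g \<Rightarrow> complex^'n^'n) \<Rightarrow> bool" where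
  "irreducible_rep G \<rho> \<longleftrightarrow>
     (\<forall>W. vec.subspace W \<and> (\<forall>g\<in>carrier G. \<forall>w\<in>W. \<rho> g *v w \<in> W) \<longrightarrow> W = {0} \<or> W = UNIV)"

text \<open>The matrix of \<open>A \<otimes> B\<close> in the basis \<open>e\<^sub>i \<otimes> e\<^sub>j\<close>, indexed by the pairs \<open>(i, j)\<close>.\<close>

definition kronecker ::
  "'a::comm_semiring_1^'n^'n \<Rightarrow> 'a^'m^'m \<Rightarrow> 'a^('n \<times> 'm)^('n \<times> 'm)" where
  "kronecker A B = (\<chi> p q. A $ fst p $ fst q * B $ snd p $ snd q)"

definition tensor_rep ::
  "('g \<Rightarrow> complex^'n^'n) \<Rightarrow> ('g \<Rightarrow> complex^'m^'m) \<Rightarrow> 'g \<Rightarrow> complex^('n \<times> 'm)^('n \<times> 'm)" where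
  "tensor_rep \<alpha> \<beta> = (\<lambda>g. kronecker (\<alpha> g) (\<beta> g))"

definition charpoly :: "'a::comm_ring_1^'n^'n \<Rightarrow> 'a poly" where
  "charpoly A = det (mat [:0, 1:] - (\<chi> i j. [:A $ i $ j:]))"

definition eigenvalues :: "'a::idom^'n^'n \<Rightarrow> 'a multiset" where
  "eigenvalues A = proots (charpoly A)"

definition T_regular :: "(int^2^2 \<Rightarrow> complex^'n^'n) \<Rightarrow> bool" where
  "T_regular \<rho> \<longleftrightarrow> (\<forall>z. count (eigenvalues (\<rho> T_mat)) z \<le> 1)"


lemma group_SL2Z: "group SL2Z"
proof (rule groupI)
  fix A assume "A \<in> carrier SL2Z"
  hence d: "det A = 1" by (simp add: SL2Z_def)
  define B :: "int^2^2" where "B = vector [vector [A$2$2, - A$1$2], vector [- A$2$1, A$1$1]]"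
  have "det B = 1" using d by (simp add: B_def det_2 algebra_simps)
  moreover have "B ** A = mat 1" using d
    by (simp add: B_def vec_eq_iff matrix_matrix_mult_def mat_def sum_2 forall_2 det_2 algebra_simps)
  ultimately show "\<exists>B\<in>carrier SL2Z. B \<otimes>\<^bsub>SL2Z\<^esub> A = \<one>\<^bsub>SL2Z\<^esub>"
    by (auto simp: SL2Z_def)
qed (auto simp: SL2Z_def det_mul matrix_mul_assoc det_I)

lemma group_GL: "group (GL :: ('a::field^'n^'n) monoid)"
proof (rule groupI)
  fix A :: "'a^'n^'n" assume "A \<in> carrier GL"
  then obtain B where "A ** B = mat 1" "B ** A = mat 1"
    by (auto simp: GL_def invertible_def)
  thus "\<exists>B\<in>carrier GL. B \<otimes>\<^bsub>GL\<^esub> A = \<one>\<^bsub>GL\<^esub>"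
    by (auto simp: GL_def invertible_def)
qed (auto simp: GL_def invertible_mult matrix_mul_assoc, auto simp: invertible_def)

lemma T_mat_in_SL2Z: "T_mat \<in> carrier SL2Z"
  by (simp add: T_mat_def SL2Z_def det_2)

lemma kronecker_mult: "kronecker A B ** kronecker C D = kronecker (A ** C) (B ** D)"
  by (simp add: kronecker_def matrix_matrix_mult_def vec_eq_iff sum_product
        sum.cartesian_product case_prod_unfold algebra_simps flip: UNIV_Times_UNIV)

lemma kronecker_mat_1: "kronecker (mat 1) (mat 1) = mat 1"
  by (auto simp: kronecker_def mat_def vec_eq_iff)

lemma is_rep_tensor:
  fixes \<alpha> :: "'g \<Rightarrow> complex^'n^'n" and \<beta> :: "'g \<Rightarrow> complex^'m^'m"
  assumes "is_rep G \<alpha>" "is_rep G \<beta>"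
  shows "is_rep G (tensor_rep \<alpha> \<beta>)"
proof -
  have "invertible (kronecker A B)" if "invertible A" "invertible B"
    for A :: "complex^'n^'n" and B :: "complex^'m^'m"
    using that unfolding invertible_def by (metis kronecker_mult kronecker_mat_1)
  thus ?thesis using assms
    by (auto simp: is_rep_def hom_def GL_def tensor_rep_def kronecker_mult Pi_iff)
qed

lemma poly_charpoly: "poly (charpoly A) z = det (mat z - A)"
proof -
  have "poly (of_int k) z = of_int k" for k :: int
    by (cases k) (auto simp: of_nat_poly)
  thus ?thesis
    by (auto simp: charpoly_def det_def poly_sum poly_prod mat_def if_distrib [of "\<lambda>p. poly p z"] cong: if_cong)
qed

lemma poly_charpoly_eq_0_iff:
  fixes A :: "'a::field^'n^'n"
  shows "poly (charpoly A) z = 0 \<longleftrightarrow> (\<exists>v. v \<noteq> 0 \<and> A *v v = z *s v)"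
proof -
  have "det (mat z - A) \<noteq> 0 \<longleftrightarrow> (\<forall>v. (mat z - A) *v v = 0 \<longrightarrow> v = 0)"
    by (metis invertible_det_nz invertible_left_inverse matrix_left_invertible_ker)
  moreover have "mat z *v v = z *s v" for v :: "'a^'n"
    by (simp add: matrix_vector_mult_def mat_def vec_eq_iff if_distrib
          if_distribR cong: if_cong)
  ultimately show ?thesis
    by (auto simp: poly_charpoly matrix_vector_mult_diff_rdistrib)
qed

end

theory Submission
  imports Defs
begin

text \<open>
  Let \<open>a, b\<close> be the eigenvalues of \<open>\<alpha>(T)\<close>, in either order, and \<open>v\<close> an eigenvector for \<open>a\<close>.
  If \<open>\<alpha>\<close> is irreducible then \<open>w = \<alpha>(S) v\<close> completes \<open>v\<close> to a basis, \<open>S\<^sup>2\<close> acts as a scalar by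
  Schur's lemma, and the relation \<open>(S T)\<^sup>3 = S\<^sup>2\<close> leaves only
  \<open>S = ((0, -x\<^sup>3), (1, 0))\<close>, \<open>T = ((a, x), (0, b))\<close> with \<open>a b x = 1\<close>.

  Let \<open>c, d, v', w', y\<close> be the same data for \<open>\<beta>\<close>. The claim is that \<open>\<alpha> \<otimes> \<beta>\<close> is irreducible iff
  \<open>a d \<noteq> b c\<close> and \<open>a c \<noteq> b d\<close>, which is a reformulation of the regularity conditions.
  An invariant subspace containing \<open>v \<otimes> v'\<close> contains \<open>w \<otimes> w'\<close>, hence
  \<open>u = x d (v \<otimes> w') + b y (w \<otimes> v')\<close> (from \<open>T(w \<otimes> w')\<close>) and \<open>S u\<close>; the last two are linearly independent iff
  \<open>a d \<noteq> b c\<close>, and otherwise \<open>v \<otimes> v'\<close>, \<open>w \<otimes> w'\<close>, \<open>u\<close> span an invariant hyperplane. If \<open>a d \<noteq> b c\<close> and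
  \<open>a c \<noteq> b d\<close> then the eigenvectors of \<open>T\<close> are, after exchanging \<open>a, b\<close> or \<open>c, d\<close>, multiples of
  \<open>v \<otimes> v'\<close>, and every nonzero invariant subspace contains one.
\<close>

section \<open>Generation of SL2(Z) by S and T\<close>

definition S_mat :: "int^2^2" where
  "S_mat = vector [vector [0, -1], vector [1, 0]]"

lemma S_mat_in_SL2Z: "S_mat \<in> carrier SL2Z"
  by (simp add: S_mat_def SL2Z_def det_2)

lemma mat_2_eq_iff: "A = B \<longleftrightarrow> A$1$1 = B$1$1 \<and> A$1$2 = B$1$2 \<and> A$2$1 = B$2$1 \<and> A$2$2 = B$2$2"
  for A B :: "'a^2^2"
  by (auto simp: vec_eq_iff forall_2)

lemma matrix_mul_2: "(A ** B)$i$j = A$i$1 * B$1$j + A$i$2 * B$2$j"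
  for A B :: "'a::semiring_1^2^2"
  by (simp add: matrix_matrix_mult_def sum_2)

lemmas SL2Z_calc = mat_2_eq_iff matrix_mul_2 S_mat_def T_mat_def mat_def

text \<open>No step for \<open>T\<^sup>-\<^sup>1\<close> is needed, since \<open>T\<^sup>-\<^sup>1 = (S T)\<^sup>5 S\<close>; the rest is Euclid's algorithm on the
  first column.\<close>

lemma SL2Z_induct [consumes 1, case_names one S T]:
  assumes "g \<in> carrier SL2Z"
    and one: "P (mat 1)"
    and S: "\<And>g. g \<in> carrier SL2Z \<Longrightarrow> P g \<Longrightarrow> P (S_mat ** g)"
    and T: "\<And>g. g \<in> carrier SL2Z \<Longrightarrow> P g \<Longrightarrow> P (T_mat ** g)"
  shows "P g"
proof -
  define Q where "Q g \<longleftrightarrow> g \<in> carrier SL2Z \<and> P g" for g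
  have Q: "Q (S_mat ** g)" "Q (T_mat ** g)" if "Q g" for g
    using that S T S_mat_in_SL2Z T_mat_in_SL2Z
    by (auto simp: Q_def SL2Z_def det_mul)
  have Sinv: "Q g" if "Q (S_mat ** g)" for g
  proof -
    \<comment> \<open>\<open>S_mat\<close> has order 4, so three further factors undo one.\<close>
    have "S_mat ** (S_mat ** (S_mat ** (S_mat ** g))) = g"
      by (simp add: SL2Z_calc)
    with Q(1)[OF Q(1)[OF Q(1)[OF that]]] show ?thesis by simp
  qed
  have Tinv: "Q g" if "Q (T_mat ** g)" for g
  proof -
    define h where "h = T_mat ** g"
    define R :: "int^2^2 \<Rightarrow> int^2^2" where "R k = S_mat ** (T_mat ** k)" for k
    have RQ: "Q (R k)" if "Q k" for k
      using that unfolding R_def by (intro Q)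
    have "R (R (R (R (R (S_mat ** h))))) = g"
      by (simp add: SL2Z_calc R_def h_def)
    moreover have "Q (R (R (R (R (R (S_mat ** h))))))"
      using that by (intro RQ Q(1)) (simp add: h_def)
    ultimately show ?thesis by simp
  qed
  \<comment> \<open>\<open>U k\<close> is the k-th power of T for every integer k.\<close>
  define U :: "int \<Rightarrow> int^2^2" where "U k = vector [vector [1, k], vector [0, 1]]" for k
  have U_pos: "Q (U (int n) ** g) \<longleftrightarrow> Q g" for n g
  proof (induction n)
    case 0
    have "U 0 = mat 1" by (simp add: U_def SL2Z_calc)
    then show ?case by simp
  next
    case (Suc n)
    have "U (int (Suc n)) ** g = T_mat ** (U (int n) ** g)"
      by (simp add: U_def SL2Z_calc algebra_simps)
    then show ?case using Suc Q(2) Tinv by metis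
  qed
  have U: "Q (U k ** g) \<longleftrightarrow> Q g" for k g
  proof (cases "k \<ge> 0")
    case True
    then show ?thesis using U_pos[of "nat k"] by simp
  next
    case False
    have "U (- k) ** (U k ** g) = g" by (simp add: U_def SL2Z_calc algebra_simps)
    then show ?thesis using U_pos[of "nat (- k)" "U k ** g"] False by simp
  qed
  have "Q g" if "det g = 1" for g
    using that
  proof (induction "nat \<bar>g$2$1\<bar>" arbitrary: g rule: less_induct)
    case less
    show ?case
    proof (cases "g$2$1 = 0")
      case True
      then have d: "g$1$1 * g$2$2 = 1" using less.prems by (simp add: det_2)
      have base: "Q (mat 1)" using one by (simp add: Q_def SL2Z_def det_I)
      from d consider "g$1$1 = 1" "g$2$2 = 1" | "g$1$1 = -1" "g$2$2 = -1"
        by (auto simp: zmult_eq_1_iff)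
      then show ?thesis
      proof cases
        case 1
        then have "g = U (g$1$2) ** mat 1" using True by (simp add: U_def SL2Z_calc)
        then show ?thesis using U base by metis
      next
        case 2
        \<comment> \<open>S^2 is -1, which supplies the sign of the diagonal.\<close>
        then have "g = U (- g$1$2) ** (S_mat ** (S_mat ** mat 1))"
          using True by (simp add: U_def SL2Z_calc)
        then show ?thesis using U base Q(1) by metis
      qed
    next
      case False
      \<comment> \<open>Left multiplication by \<open>U\<close> replaces \<open>g$1$1\<close> by its
        remainder modulo \<open>g$2$1\<close>, and S moves that remainder to the lower left, where
        it is smaller in absolute value than \<open>g$2$1\<close>.\<close>
      define h where "h = S_mat ** (U (- (g$1$1 div g$2$1)) ** g)"
      have "h$2$1 = g$1$1 mod g$2$1"
        by (simp add: h_def U_def SL2Z_calc minus_div_mult_eq_mod algebra_simps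
             flip: minus_mult_div_eq_mod)
      then have "\<bar>h$2$1\<bar> < \<bar>g$2$1\<bar>" using False by (simp add: abs_mod_less)
      moreover have "det h = 1" using less.prems
        unfolding h_def det_mul by (simp add: U_def S_mat_def det_2[of "vector _"])
      ultimately have "Q h" using less.hyps[of h] False by simp
      then show ?thesis using Sinv U unfolding h_def by blast
    qed
  qed
  then show ?thesis using assms(1) by (auto simp: Q_def SL2Z_def)
qed

section \<open>Representations and invariance under the generators\<close>

lemma is_rep_mat_1: "is_rep SL2Z \<rho> \<Longrightarrow> \<rho> (mat 1) = mat 1"
  using hom_one[OF _ group_SL2Z group_GL, of \<rho>] by (simp add: is_rep_def SL2Z_def GL_def)

lemma is_rep_mult:
  "is_rep SL2Z \<rho> \<Longrightarrow> g \<in> carrier SL2Z \<Longrightarrow> h \<in> carrier SL2Z \<Longrightarrow> \<rho> (g ** h) = \<rho> g ** \<rho> h"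
  by (auto simp: is_rep_def hom_def SL2Z_def GL_def)

lemma is_rep_invertible: "is_rep SL2Z \<rho> \<Longrightarrow> g \<in> carrier SL2Z \<Longrightarrow> invertible (\<rho> g)"
  by (auto simp: is_rep_def hom_def SL2Z_def GL_def)

text \<open>\<open>SL2Z_induct\<close> writes each group element as a word in S and T without
  inverses, so stability passes along the word.\<close>

lemma invariant_if_invariant_S_T:
  assumes "is_rep SL2Z \<rho>" and "\<forall>w\<in>W. \<rho> S_mat *v w \<in> W" and "\<forall>w\<in>W. \<rho> T_mat *v w \<in> W"
  shows "\<forall>g\<in>carrier SL2Z. \<forall>w\<in>W. \<rho> g *v w \<in> W"
proof
  fix g assume "g \<in> carrier SL2Z"
  then show "\<forall>w\<in>W. \<rho> g *v w \<in> W"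
  proof (induction g rule: SL2Z_induct)
    case one
    then show ?case using assms(1) by (simp add: is_rep_mat_1)
  next
    case (S g)
    then show ?case using assms S_mat_in_SL2Z
      by (simp add: is_rep_mult flip: matrix_vector_mul_assoc)
  next
    case (T g)
    then show ?case using assms T_mat_in_SL2Z
      by (simp add: is_rep_mult flip: matrix_vector_mul_assoc)
  qed
qed

lemma irreducible_repD:
  assumes "is_rep SL2Z \<rho>" "irreducible_rep SL2Z \<rho>" "vec.subspace W"
    and "\<And>w. w \<in> W \<Longrightarrow> \<rho> S_mat *v w \<in> W" and "\<And>w. w \<in> W \<Longrightarrow> \<rho> T_mat *v w \<in> W"
  shows "W = {0} \<or> W = UNIV"
  using assms invariant_if_invariant_S_T[of \<rho> W] unfolding irreducible_rep_def by blast

section \<open>Eigenvalues of 2x2 matrices and of their Kronecker products\<close>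

lemma charpoly_2: "charpoly A = [:det A, - trace A, 1:]" for A :: "'a::comm_ring_1^2^2"
  by (simp add: charpoly_def det_2 trace_def sum_2 mat_def algebra_simps)

lemma eigenvalues_2:
  fixes A :: "'a::idom^2^2"
  assumes "trace A = a + b" "det A = a * b"
  shows "eigenvalues A = {#a, b#}"
proof -
  have "charpoly A = [:-a, 1:] * [:-b, 1:]"
    using assms by (simp add: charpoly_2)
  then show ?thesis by (simp add: eigenvalues_def proots_mult del: mult_pCons_left mult_pCons_right)
qed

lemma UNIV_2_2: "(UNIV :: (2 \<times> 2) set) = {(1,1), (1,2), (2,1), (2,2)}"
  by (auto simp: UNIV_2 simp flip: UNIV_Times_UNIV)

text \<open>Both sides agree as polynomial functions: expanding the determinant shows that the
  coefficients depend on \<open>A\<close> and \<open>B\<close> only through traces and determinants,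
  which are symmetric in \<open>a, b\<close> and in \<open>c, d\<close>.\<close>

lemma charpoly_kronecker_2:
  fixes A B :: "'a::field_char_0^2^2"
  assumes "trace A = a + b" "det A = a * b" "trace B = c + d" "det B = c * d"
  shows "charpoly (kronecker A B) = [:-(a*c), 1:] * [:-(a*d), 1:] * [:-(b*c), 1:] * [:-(b*d), 1:]"
proof -
  define t u where "t = trace A" "u = trace B"
  have "poly (charpoly (kronecker A B)) z = 
      z^4 - t * u * z^3 + (t\<^sup>2 * det B + u\<^sup>2 * det A - 2 * det A * det B) * z\<^sup>2
      - t * u * det A * det B * z + (det A)\<^sup>2 * (det B)\<^sup>2" (is "_ = ?rhs z") for z
  proof -
    \<comment> \<open>These facts peel the four indices off one at a time, turning the sum over
      permutations into an explicit one.\<close>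
    have f: "finite {(1::2,2::2),(2,1),(2,2)}" "(1,1) \<notin> {(1::2,2::2),(2,1),(2,2)}"
       "finite {(2::2,1::2),(2,2)}" "(1,2) \<notin> {(2::2,1::2),(2,2)}"
       "finite {(2::2,2::2)}" "(2,1) \<notin> {(2::2,2::2)}" by auto
    show ?thesis
      unfolding poly_charpoly det_def[of "mat z - kronecker A B"] UNIV_2_2
      unfolding sum_over_permutations_insert[OF f(1,2)]
      unfolding sum_over_permutations_insert[OF f(3,4)]
      unfolding sum_over_permutations_insert[OF f(5,6)]
      unfolding permutes_sing
      by (simp add: sign_swap_id permutation_swap_id sign_compose swap_id_eq kronecker_def
           mat_def permutation_compose t_u_def trace_def sum_2 det_2)
        (simp add: algebra_simps power2_eq_square power3_eq_cube power4_eq_xxxx)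
  qed
  moreover have "poly ([:-(a*c), 1:] * [:-(a*d), 1:] * [:-(b*c), 1:] * [:-(b*d), 1:]) z = ?rhs z" for z
    unfolding t_u_def assms by (simp add: algebra_simps power2_eq_square power3_eq_cube power4_eq_xxxx)
  ultimately show ?thesis by (metis poly_eq_poly_eq_iff ext)
qed

lemma eigenvalues_kronecker_2:
  fixes A B :: "'a::field_char_0^2^2"
  assumes "trace A = a + b" "det A = a * b" "trace B = c + d" "det B = c * d"
  shows "eigenvalues (kronecker A B) = {#a*c, a*d, b*c, b*d#}"
  by (simp add: eigenvalues_def charpoly_kronecker_2[OF assms] proots_mult add_mset_commute
      del: mult_pCons_left mult_pCons_right)


lemma T_regular_eq_2:
  assumes "eigenvalues (\<rho> T_mat) = {#a, b#}"
  shows "T_regular \<rho> \<longleftrightarrow> a \<noteq> b"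
  by (auto simp: T_regular_def assms)

lemma T_regular_eq_4:
  assumes "eigenvalues (\<rho> T_mat) = {#a, b, c, d#}"
  shows "T_regular \<rho> \<longleftrightarrow> distinct [a, b, c, d]"
  unfolding T_regular_def assms by (auto split: if_splits)

lemma mat_scalar_mult_vec: "mat z *v v = z *s v" for v :: "'a::comm_semiring_1^'n"
  by (simp add: matrix_vector_mult_def mat_def vec_eq_iff if_distrib if_distribR cong: if_cong)

text \<open>The quadratic formula. Describing the eigenvalues by trace and determinant covers the
  case \<open>a = b\<close> as well.\<close>

lemma ex_eigenvalues_2:
  fixes A :: "complex^2^2"
  obtains a b where "trace A = a + b" "det A = a * b"
proof
  let ?r = "csqrt ((trace A)\<^sup>2 - 4 * det A)"
  show "trace A = (trace A + ?r) / 2 + (trace A - ?r) / 2" by (simp add: field_simps)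
  have "((trace A + ?r) / 2) * ((trace A - ?r) / 2) = ((trace A)\<^sup>2 - ?r\<^sup>2) / 4"
    by (simp add: field_simps power2_eq_square)
  then show "det A = ((trace A + ?r) / 2) * ((trace A - ?r) / 2)" by simp
qed

lemma ex_eigenvector_2:
  fixes A :: "'a::field^2^2"
  assumes "trace A = a + b" "det A = a * b"
  obtains v where "v \<noteq> 0" "A *v v = a *s v"
proof -
  have "poly (charpoly A) a = 0"
    using assms by (simp add: charpoly_2 algebra_simps)
  then show ?thesis using that poly_charpoly_eq_0_iff by blast
qed

section \<open>Schur's lemma and the normal form of an irreducible representation\<close>

text \<open>An eigenspace of \<open>E\<close> is stable under S and T because both commute with
  \<open>E\<close>; it is nonzero, hence everything by irreducibility.\<close>

lemma Schur_2:
  fixes \<rho> :: "int^2^2 \<Rightarrow> complex^2^2"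
  assumes rep: "is_rep SL2Z \<rho>" and irr: "irreducible_rep SL2Z \<rho>"
    and S: "\<rho> S_mat ** E = E ** \<rho> S_mat" and T: "\<rho> T_mat ** E = E ** \<rho> T_mat"
  obtains e where "E = mat e"
proof -
  obtain e f where "trace E = e + f" "det E = e * f" by (rule ex_eigenvalues_2)
  then obtain v where v: "v \<noteq> 0" "E *v v = e *s v" by (rule ex_eigenvector_2)
  define W where "W = {u. E *v u = e *s u}"
  have "vec.subspace W"
    by (auto simp: W_def vec.subspace_def matrix_vector_right_distrib vec.scale_right_distrib
        vector_scalar_commute mult.commute)
  moreover have "\<rho> g *v w \<in> W" if "\<rho> g ** E = E ** \<rho> g" "w \<in> W" for g w
    using that by (metis (mono_tags) W_def matrix_vector_mul_assoc mem_Collect_eq vector_scalar_commute)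
  ultimately have "W = {0} \<or> W = UNIV" using irreducible_repD[OF rep irr] S T by blast
  then have "W = UNIV" using v by (auto simp: W_def)
  then have "E = mat e" by (auto simp: W_def matrix_eq mat_scalar_mult_vec)
  then show ?thesis by (rule that)
qed

text \<open>The entry \<open>- (x^3)\<close> is the scalar by which S^2 acts.\<close>

definition S_nf :: "complex \<Rightarrow> complex^2^2" where
  "S_nf x = vector [vector [0, - (x^3)], vector [1, 0]]"

definition T_nf :: "complex \<Rightarrow> complex \<Rightarrow> complex \<Rightarrow> complex^2^2" where
  "T_nf a b x = vector [vector [a, x], vector [0, b]]"

lemma matrix_left_cancel:
  fixes P :: "'a::field^'n^'n"
  assumes "invertible P" "P ** A = P ** B" shows "A = B"
  using assms by (metis invertible_def matrix_mul_assoc matrix_mul_lid)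

text \<open>Carries a relation between the images of S and T over to their matrices in the basis
  given by the columns of \<open>P\<close>.\<close>

lemma matrix_intertwine_mult:
  fixes P :: "'a::comm_semiring_1^'n^'n"
  assumes "A ** P = P ** A0" "B ** P = P ** B0"
  shows "(A ** B) ** P = P ** (A0 ** B0)"
  using assms by (metis matrix_mul_assoc)

text \<open>As \<open>a * b * x = 1\<close> fixes \<open>x\<close>, the eigenvalues determine the
  representation up to equivalence. The order of \<open>a\<close> and \<open>b\<close> is free; the
  later exchanges of eigenvalues rest on this.\<close>

lemma irreducible_normal_form:
  fixes \<rho> :: "int^2^2 \<Rightarrow> complex^2^2"
  assumes rep: "is_rep SL2Z \<rho>" and irr: "irreducible_rep SL2Z \<rho>"
    and tr: "trace (\<rho> T_mat) = a + b" and dt: "det (\<rho> T_mat) = a * b"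
  obtains P x where "invertible P" "\<rho> S_mat ** P = P ** S_nf x" "\<rho> T_mat ** P = P ** T_nf a b x"
    "a * b * x = 1"
proof -
  define A B where "A = \<rho> S_mat" and "B = \<rho> T_mat"
  note mem = S_mat_in_SL2Z T_mat_in_SL2Z
  have SS: "S_mat ** S_mat \<in> carrier SL2Z" and ST: "S_mat ** T_mat \<in> carrier SL2Z"
    and STST: "(S_mat ** T_mat) ** (S_mat ** T_mat) \<in> carrier SL2Z"
    using mem by (auto simp: SL2Z_def det_mul)
  have invA: "invertible A" and invB: "invertible B"
    using is_rep_invertible[OF rep] mem by (auto simp: A_def B_def)
  have "A ** A = \<rho> (S_mat ** S_mat)" using is_rep_mult[OF rep] mem by (simp add: A_def)
  also have "S_mat ** S_mat = (S_mat ** T_mat) ** ((S_mat ** T_mat) ** (S_mat ** T_mat))"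
    by (simp add: SL2Z_calc)
  also have "\<rho> \<dots> = (A ** B) ** ((A ** B) ** (A ** B))"
    using is_rep_mult[OF rep] mem ST STST by (simp add: A_def B_def)
  finally have cube: "A ** A = (A ** B) ** ((A ** B) ** (A ** B))" .
  \<comment> \<open>\<open>S_mat ** S_mat\<close> is -1, hence central, and Schur's lemma makes its
    image a scalar \<open>e\<close>.\<close>
  have "S_mat ** S_mat ** T_mat = T_mat ** (S_mat ** S_mat)" by (simp add: SL2Z_calc)
  then have "A ** A ** B = B ** (A ** A)"
    using is_rep_mult[OF rep] mem SS unfolding A_def B_def by metis
  then obtain e where e: "A ** A = mat e"
    using Schur_2[OF rep irr, of "A ** A"] unfolding A_def B_def by (metis matrix_mul_assoc)
  obtain v where v: "v \<noteq> 0" "B *v v = a *s v"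
    using ex_eigenvector_2 tr dt unfolding B_def by metis
  \<comment> \<open>The columns are \<open>v\<close> and \<open>A *v v\<close>. Were they dependent,
    the line through \<open>v\<close> would be invariant under both generators.\<close>
  define P :: "complex^2^2" where "P = vector [vector [v$1, (A *v v)$1], vector [v$2, (A *v v)$2]]"
  have "det P \<noteq> 0"
  proof
    assume "det P = 0"
    then have d: "v$1 * (A *v v)$2 = (A *v v)$1 * v$2" by (simp add: P_def det_2)
    define W where "W = range (\<lambda>c. c *s v)"
    have W: "u \<in> W" if "v$1 * u$2 = u$1 * v$2" for u
    proof (cases "v$1 = 0")
      case True
      then have "v$2 \<noteq> 0" using v by (auto simp: vec_eq_iff forall_2)
      then have "u = (u$2 / v$2) *s v" using that True by (auto simp: vec_eq_iff forall_2)
      then show ?thesis unfolding W_def by blast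
    next
      case False
      then have "u = (u$1 / v$1) *s v" using that
        by (auto simp: vec_eq_iff forall_2 field_simps)
      then show ?thesis unfolding W_def by blast
    qed
    have "vec.subspace W"
      unfolding W_def vec.span_singleton[symmetric] by (rule vec.subspace_span)
    moreover obtain k where "A *v v = k *s v" using W[OF d] by (auto simp: W_def)
    then have "A *v w \<in> W" "B *v w \<in> W" if "w \<in> W" for w
      using that v(2) by (auto simp: W_def vector_scalar_commute)
    ultimately have "W = {0} \<or> W = UNIV"
      using irreducible_repD[OF rep irr] unfolding A_def B_def by blast
    moreover have "v \<in> W" by (rule W) simp
    ultimately have "W = UNIV" using v by auto
    then have "vector [1, 0] \<in> W" "vector [0, 1] \<in> W" by auto
    then have "v$2 = 0" "v$1 = 0" by (auto simp: W_def vec_eq_iff forall_2)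
    then show False using v by (auto simp: vec_eq_iff forall_2)
  qed
  then have P: "invertible P" by (simp add: invertible_det_nz)
  have "det B \<noteq> 0" using invB by (simp add: invertible_det_nz)
  then have ab: "a \<noteq> 0" "b \<noteq> 0" using dt by (auto simp: B_def)
  have AP: "A ** P = P ** vector [vector [0, e], vector [1, 0]]"
  proof -
    have "A *v (A *v v) = e *s v" by (simp add: matrix_vector_mul_assoc e mat_scalar_mult_vec)
    then have "A$1$1 * (A *v v)$1 + A$1$2 * (A *v v)$2 = e * v$1"
       "A$2$1 * (A *v v)$1 + A$2$2 * (A *v v)$2 = e * v$2"
      by (auto simp: vec_eq_iff forall_2 matrix_vector_mult_def sum_2)
    moreover have "(A *v v)$i = A$i$1 * v$1 + A$i$2 * v$2" for i
      by (simp add: matrix_vector_mult_def sum_2)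
    ultimately show ?thesis by (simp add: mat_2_eq_iff matrix_mul_2 P_def mult.commute)
  qed
  obtain P' where P': "P ** P' = mat 1" "P' ** P = mat 1"
    using P by (auto simp: invertible_def)
  \<comment> \<open>The matrix of T in the new basis: the eigenvector \<open>v\<close> gives its
    first column, the determinant its lower right entry, and the remaining entry is named
    \<open>x\<close>.\<close>
  define M where "M = P' ** B ** P"
  have BP: "B ** P = P ** M"
    by (simp add: M_def matrix_mul_assoc P')
  have M1: "M$1$1 = a" "M$2$1 = 0"
  proof -
    have "P *v vector [1, 0] = v"
      by (simp add: P_def vec_eq_iff forall_2 matrix_vector_mult_def sum_2)
    then have "M *v vector [1, 0] = P' *v (a *s (P *v vector [1, 0]))"
      by (simp add: M_def v flip: matrix_vector_mul_assoc)
    also have "\<dots> = a *s vector [1, 0]"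
      by (simp only: vector_scalar_commute matrix_vector_mul_assoc P' matrix_vector_mul_lid)
    finally show "M$1$1 = a" "M$2$1 = 0"
      by (auto simp: vec_eq_iff forall_2 matrix_vector_mult_def sum_2)
  qed
  have "det B * det P = det P * det M" using BP by (metis det_mul)
  then have "M$2$2 = b" using \<open>det P \<noteq> 0\<close> dt M1 ab by (simp add: det_2[of M] B_def)
  define x where "x = M$1$2"
  have M: "M = T_nf a b x"
    by (simp add: mat_2_eq_iff T_nf_def x_def M1 \<open>M$2$2 = b\<close>)
  define A0 :: "complex^2^2" where "A0 = vector [vector [0, e], vector [1, 0]]"
  have AP: "A ** P = P ** A0" using AP by (simp add: A0_def)
  have "P ** (A0 ** A0) = A ** A ** P"
    using matrix_intertwine_mult[OF AP AP] by simp
  also have "\<dots> = P ** ((A0 ** M) ** ((A0 ** M) ** (A0 ** M)))"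
    unfolding cube by (intro matrix_intertwine_mult AP BP)
  finally have cube0: "A0 ** A0 = (A0 ** M) ** ((A0 ** M) ** (A0 ** M))"
    by (rule matrix_left_cancel[OF P])
  have "e \<noteq> 0"
  proof
    assume "e = 0"
    then have "det (A ** A) = 0" unfolding e by (simp add: det_2 mat_def)
    then show False using invA by (simp add: det_mul invertible_det_nz)
  qed
  \<comment> \<open>The (1,1) and (2,1) entries of \<open>cube0\<close>. Cancelling \<open>e\<close>
    and \<open>a\<close> gives \<open>a * b * x = 1\<close> and \<open>e * a * b = - (x^2)\<close>,
    which together force \<open>e = - (x^3)\<close>.\<close>
  have "e * b * a * x = e" "a * (e * a * b + x\<^sup>2) = 0"
    using cube0 by (auto simp: mat_2_eq_iff matrix_mul_2 A0_def M T_nf_def algebra_simps power2_eq_square)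
  then have abx: "a * b * x = 1" and "e * a * b = - (x\<^sup>2)"
    using ab \<open>e \<noteq> 0\<close> by (auto simp: eq_neg_iff_add_eq_0 mult_ac)
  have "e = e * (a * b * x)" using abx by simp
  also have "\<dots> = e * a * b * x" by simp
  also have "\<dots> = - (x^3)" using \<open>e * a * b = - (x\<^sup>2)\<close> by (simp add: power3_eq_cube power2_eq_square)
  finally have "A0 = S_nf x" by (simp add: A0_def S_nf_def)
  then show ?thesis using that P AP BP M abx by (simp add: A_def B_def)
qed

section \<open>The tensor product in normal form\<close>

text \<open>Coordinates with respect to \<open>v \<otimes> v'\<close>, \<open>v \<otimes> w'\<close>, \<open>w \<otimes> v'\<close>, \<open>w \<otimes> w'\<close>.\<close>

definition vec4 :: "'a \<Rightarrow> 'a \<Rightarrow> 'a \<Rightarrow> 'a \<Rightarrow> 'a^(2 \<times> 2)" where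
  "vec4 p q r s = (\<chi> i. if i = (1,1) then p else if i = (1,2) then q else if i = (2,1) then r else s)"

lemma vec4_nth [simp]:
  "vec4 p q r s $ (1,1) = p" "vec4 p q r s $ (1,2) = q"
  "vec4 p q r s $ (2,1) = r" "vec4 p q r s $ (2,2) = s"
  by (auto simp: vec4_def)

lemma vec_2_2_eq_iff:
  "X = Y \<longleftrightarrow> X$(1,1) = Y$(1,1) \<and> X$(1,2) = Y$(1,2) \<and> X$(2,1) = Y$(2,1) \<and> X$(2,2) = Y$(2,2)"
  for X Y :: "'a^(2 \<times> 2)"
  by (auto simp: vec_eq_iff forall_2 split_paired_All)

lemma vec4_cases: obtains p q r s where "X = vec4 p q r s"
  by (rule that[of "X$(1,1)" "X$(1,2)" "X$(2,1)" "X$(2,2)"]) (simp add: vec_2_2_eq_iff)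

lemma vec4_simps:
  "vec4 p q r s + vec4 p' q' r' s' = vec4 (p + p') (q + q') (r + r') (s + s' :: 'a::comm_ring_1)"
  "vec4 p q r s - vec4 p' q' r' s' = vec4 (p - p') (q - q') (r - r') (s - s')"
  "k *s vec4 p q r s = vec4 (k * p) (k * q) (k * r) (k * s)"
  "vec4 p q r s = vec4 p' q' r' s' \<longleftrightarrow> p = p' \<and> q = q' \<and> r = r' \<and> s = s'"
  "vec4 p q r s = 0 \<longleftrightarrow> p = 0 \<and> q = 0 \<and> r = 0 \<and> s = 0"
  by (auto simp: vec_2_2_eq_iff)

lemma kronecker_mult_vec_2:
  "(kronecker A B *v X) $ (i, j) = A$i$1 * B$j$1 * X$(1,1) + A$i$1 * B$j$2 * X$(1,2)
     + A$i$2 * B$j$1 * X$(2,1) + A$i$2 * B$j$2 * X$(2,2)"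
  for A B :: "'a::comm_ring_1^2^2"
  by (simp add: kronecker_def matrix_vector_mult_def UNIV_2_2 add.assoc)

lemma kronecker_S_nf:
  "kronecker (S_nf x) (S_nf y) *v vec4 p q r s = vec4 (x^3 * y^3 * s) (- (x^3) * r) (- (y^3) * q) p"
  by (simp add: vec_2_2_eq_iff kronecker_mult_vec_2 S_nf_def)

lemma kronecker_T_nf:
  "kronecker (T_nf a b x) (T_nf c d y) *v vec4 p q r s =
     vec4 (a*c*p + a*y*q + x*c*r + x*y * s) (a*d*q + x*d * s) (b*c*r + b*y * s) (b*d * s)"
  by (simp add: vec_2_2_eq_iff kronecker_mult_vec_2 T_nf_def)

lemma tensor_nf_generated:
  assumes W: "vec.subspace W"
    and S: "\<And>w. w \<in> W \<Longrightarrow> kronecker (S_nf x) (S_nf y) *v w \<in> W"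
    and T: "\<And>w. w \<in> W \<Longrightarrow> kronecker (T_nf a b x) (T_nf c d y) *v w \<in> W"
    and x: "a * b * x = 1" and y: "c * d * y = 1" and ne: "a * d \<noteq> b * c"
    and "vec4 1 0 0 0 \<in> W"
  shows "W = UNIV"
proof -
  note sub = vec.subspace_add[OF W] vec.subspace_diff[OF W] vec.subspace_scale[OF W]
  have nz: "a \<noteq> 0" "b \<noteq> 0" "c \<noteq> 0" "d \<noteq> 0" "x \<noteq> 0" "y \<noteq> 0" using x y by auto
  note e11 = \<open>vec4 1 0 0 0 \<in> W\<close>
  have e22: "vec4 0 0 0 1 \<in> W" using S[OF e11] by (simp add: kronecker_S_nf)
  have "vec4 (x*y) (x*d) (b*y) (b*d) - (x*y) *s vec4 1 0 0 0 - (b*d) *s vec4 0 0 0 1 \<in> W"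
    using T[OF e22] by (intro sub e11 e22) (simp add: kronecker_T_nf)
  then have u: "vec4 0 (x*d) (b*y) 0 \<in> W" by (simp add: vec4_simps)
  have Su: "vec4 0 (- (x^3) * (b*y)) (- (y^3) * (x*d)) 0 \<in> W"
    using S[OF u] by (simp add: kronecker_S_nf)
  \<comment> \<open>Up to sign, the determinant of the middle coordinates of the vectors in
    \<open>u\<close> and \<open>Su\<close>; the combination below cancels the third coordinate and
    leaves \<open>k\<close> in the second.\<close>
  define k where "k = x * d * y^3 * (x*d) + b * y * (- (x^3) * (b*y))"
  have "(x * d * y^3) *s vec4 0 (x*d) (b*y) 0 + (b*y) *s vec4 0 (- (x^3) * (b*y)) (- (y^3) * (x*d)) 0 \<in> W"
    by (intro sub u Su)
  then have k: "vec4 0 k 0 0 \<in> W" by (simp add: vec4_simps k_def algebra_simps)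
  \<comment> \<open>The factor \<open>a * b * c * d\<close> allows the relations \<open>x\<close>
    and \<open>y\<close> to be used, which exposes \<open>a * d - b * c\<close>.\<close>
  have "k * (a * b * c * d) = x\<^sup>2 * y\<^sup>2 * (d\<^sup>2 * (a * b) * (c * d * y) - b\<^sup>2 * (c * d) * (a * b * x))"
    by (simp add: k_def algebra_simps power2_eq_square power3_eq_cube)
  also have "\<dots> = x\<^sup>2 * y\<^sup>2 * b * d * (a * d - b * c)"
    by (simp only: x y) (simp add: algebra_simps power2_eq_square)
  finally have "k \<noteq> 0" using ne nz by auto
  have "(1 / k) *s vec4 0 k 0 0 \<in> W" by (intro sub k)
  then have e12: "vec4 0 1 0 0 \<in> W" using \<open>k \<noteq> 0\<close> by (simp add: vec4_simps)
  have "(1 / (b*y)) *s (vec4 0 (x*d) (b*y) 0 - (x*d) *s vec4 0 1 0 0) \<in> W"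
    by (intro sub u e12)
  then have e21: "vec4 0 0 1 0 \<in> W" using nz by (simp add: vec4_simps)
  have "X \<in> W" for X
  proof -
    obtain p q r s where X: "X = vec4 p q r s" by (rule vec4_cases)
    have "p *s vec4 1 0 0 0 + q *s vec4 0 1 0 0 + r *s vec4 0 0 1 0 + s *s vec4 0 0 0 1 \<in> W"
      by (intro sub e11 e12 e21 e22)
    then show ?thesis by (simp add: vec4_simps X)
  qed
  then show ?thesis by auto
qed

text \<open>The last coordinate dies because \<open>b * d \<noteq> a * c\<close>. The second can
  survive only if \<open>c = d\<close>, the third only if \<open>a = b\<close>; both equalities at
  once would give \<open>a * d = b * c\<close>. A single survivor is killed by the first coordinate
  equation, as \<open>x\<close> and \<open>y\<close> are nonzero.\<close>

lemma tensor_nf_eigenvector: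
  assumes "kronecker (T_nf a b x) (T_nf c d y) *v X = (a * c) *s X" "X \<noteq> 0"
    and x: "a * b * x = 1" and y: "c * d * y = 1" and ne: "a * d \<noteq> b * c" "a * c \<noteq> b * d"
  obtains k where "k \<noteq> 0" "X = vec4 k 0 0 0"
proof -
  have nz: "a \<noteq> 0" "b \<noteq> 0" "c \<noteq> 0" "d \<noteq> 0" "x \<noteq> 0" "y \<noteq> 0" using x y by auto
  obtain p q r s where X: "X = vec4 p q r s" by (rule vec4_cases)
  have eq: "a*y*q + x*c*r + x*y * s = 0" "a*d*q + x*d * s = a*c*q" "b*c*r + b*y * s = a*c*r" "b*d * s = a*c * s"
    using assms(1) by (auto simp: X kronecker_T_nf vec4_simps algebra_simps)
  have s: "s = 0" using eq(4) ne by auto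
  have q: "q = 0 \<or> d = c" and r: "r = 0 \<or> b = a" using eq(2,3) nz s by auto
  have "q = 0 \<and> r = 0" using q r eq(1) nz s ne by auto
  then show ?thesis using that[of p] \<open>X \<noteq> 0\<close> s by (auto simp: X vec4_simps)
qed

text \<open>T is upper triangular with diagonal \<open>a*c\<close>, \<open>a*d\<close>,
  \<open>b*c\<close>, \<open>b*d\<close>. Subtracting these scalars from T in reverse order clears
  one coordinate after another; if no eigenvector were met, a nonzero vector would end up
  zero.\<close>

lemma tensor_nf_ex_eigenvector:
  assumes W: "vec.subspace W" "W \<noteq> {0}"
    and T: "\<And>w. w \<in> W \<Longrightarrow> kronecker (T_nf a b x) (T_nf c d y) *v w \<in> W"
  obtains X z where "X \<in> W" "X \<noteq> 0" "kronecker (T_nf a b x) (T_nf c d y) *v X = z *s X"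
    "z \<in> {a * c, a * d, b * c, b * d}"
proof -
  define K where "K = kronecker (T_nf a b x) (T_nf c d y)"
  note sub = vec.subspace_diff[OF W(1)] vec.subspace_scale[OF W(1)]
  have "0 \<in> W" using W(1) by (rule vec.subspace_0)
  then obtain X where X: "X \<in> W" "X \<noteq> 0" using W(2) by auto
  have "\<exists>X\<in>W. \<exists>z\<in>{a * c, a * d, b * c, b * d}. X \<noteq> 0 \<and> K *v X = z *s X"
  proof (rule ccontr)
    assume no: "\<not> ?thesis"
    have step: "K *v X - z *s X \<in> W" "K *v X - z *s X \<noteq> 0"
      if "X \<in> W" "X \<noteq> 0" "z \<in> {a * c, a * d, b * c, b * d}" for X z
      using that no T by (auto intro!: sub simp: K_def)
    obtain p q r s where X0: "vec4 p q r s \<in> W" "vec4 p q r s \<noteq> 0"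
      using X vec4_cases by metis
    obtain p q r where X1: "vec4 p q r 0 \<in> W" "vec4 p q r 0 \<noteq> 0"
      using step[OF X0, of "b * d"] by (auto simp: K_def kronecker_T_nf vec4_simps(2,3))
    obtain p q where X2: "vec4 p q 0 0 \<in> W" "vec4 p q 0 0 \<noteq> 0"
      using step[OF X1, of "b * c"] by (auto simp: K_def kronecker_T_nf vec4_simps(2,3))
    obtain p where X3: "vec4 p 0 0 0 \<in> W" "vec4 p 0 0 0 \<noteq> 0"
      using step[OF X2, of "a * d"] by (auto simp: K_def kronecker_T_nf vec4_simps(2,3))
    show False
      using step[OF X3, of "a * c"] by (auto simp: K_def kronecker_T_nf vec4_simps)
  qed
  then show ?thesis using that by (auto simp: K_def)
qed

section \<open>The irreducibility criterion in terms of eigenvalues\<close>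

lemma tensor_normal_form:
  fixes \<alpha> \<beta> :: "int^2^2 \<Rightarrow> complex^2^2"
  assumes "is_rep SL2Z \<alpha>" "irreducible_rep SL2Z \<alpha>" "is_rep SL2Z \<beta>" "irreducible_rep SL2Z \<beta>"
    and "trace (\<alpha> T_mat) = a + b" "det (\<alpha> T_mat) = a * b"
    and "trace (\<beta> T_mat) = c + d" "det (\<beta> T_mat) = c * d"
  obtains K L x y where "K ** L = mat 1" "L ** K = mat 1"
    "tensor_rep \<alpha> \<beta> S_mat ** K = K ** kronecker (S_nf x) (S_nf y)"
    "tensor_rep \<alpha> \<beta> T_mat ** K = K ** kronecker (T_nf a b x) (T_nf c d y)"
    "a * b * x = 1" "c * d * y = 1"
proof -
  obtain P x where P: "invertible P" "\<alpha> S_mat ** P = P ** S_nf x" "\<alpha> T_mat ** P = P ** T_nf a b x"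
    "a * b * x = 1" using irreducible_normal_form assms by metis
  obtain Q y where Q: "invertible Q" "\<beta> S_mat ** Q = Q ** S_nf y" "\<beta> T_mat ** Q = Q ** T_nf c d y"
    "c * d * y = 1" using irreducible_normal_form assms by metis
  obtain P' Q' where "P ** P' = mat 1" "P' ** P = mat 1" "Q ** Q' = mat 1" "Q' ** Q = mat 1"
    using P(1) Q(1) unfolding invertible_def by blast
  then show ?thesis
    using P Q by (intro that[of "kronecker P Q" "kronecker P' Q'" x y])
      (simp_all add: tensor_rep_def kronecker_mult kronecker_mat_1)
qed

text \<open>The order of the eigenvalues is a parameter, so every result can be reused after
  exchanging \<open>a, b\<close> or \<open>c, d\<close>.\<close>

locale tensor_2 =
  fixes \<alpha> \<beta> :: "int^2^2 \<Rightarrow> complex^2^2" and a b c d :: complex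
  assumes reps: "is_rep SL2Z \<alpha>" "irreducible_rep SL2Z \<alpha>" "is_rep SL2Z \<beta>" "irreducible_rep SL2Z \<beta>"
    and eigs: "trace (\<alpha> T_mat) = a + b" "det (\<alpha> T_mat) = a * b"
      "trace (\<beta> T_mat) = c + d" "det (\<beta> T_mat) = c * d"
begin

lemma swap_left: "tensor_2 \<alpha> \<beta> b a c d"
  using reps eigs by unfold_locales (simp_all add: ac_simps)

lemma swap_right: "tensor_2 \<alpha> \<beta> a b d c"
  using reps eigs by unfold_locales (simp_all add: ac_simps)

lemma reducible:
  assumes "a * d = b * c"
  shows "\<not> irreducible_rep SL2Z (tensor_rep \<alpha> \<beta>)"
proof
  assume irr: "irreducible_rep SL2Z (tensor_rep \<alpha> \<beta>)"
  obtain K L x y where KL: "K ** L = mat 1" "L ** K = mat 1"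
    and S: "tensor_rep \<alpha> \<beta> S_mat ** K = K ** kronecker (S_nf x) (S_nf y)"
    and T: "tensor_rep \<alpha> \<beta> T_mat ** K = K ** kronecker (T_nf a b x) (T_nf c d y)"
    and x: "a * b * x = 1" and y: "c * d * y = 1"
    by (rule tensor_normal_form[OF reps eigs])
  have nz: "a \<noteq> 0" "b \<noteq> 0" "c \<noteq> 0" "d \<noteq> 0" "x \<noteq> 0" "y \<noteq> 0" using x y by auto
  \<comment> \<open>The hyperplane whose middle coordinates are proportional to
    \<open>(x*d, b*y)\<close>, those of the vector u; \<open>W\<close> is its image under
    \<open>K\<close>.\<close>
  define H where "H = {X :: complex^(2 \<times> 2). b * y * X$(1,2) = x * d * X$(2,1)}"
  define W where "W = {X. L *v X \<in> H}"
  have "vec.subspace H"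
    by (auto simp: H_def vec.subspace_def distrib_left mult.left_commute)
  then have "vec.subspace W"
    by (auto simp: W_def vec.subspace_def matrix_vector_right_distrib vector_scalar_commute)
  have HS: "kronecker (S_nf x) (S_nf y) *v X \<in> H" if "X \<in> H" for X
  proof -
    obtain p q r s where X: "X = vec4 p q r s" by (rule vec4_cases)
    have h: "b * y * q = x * d * r" using that by (simp add: H_def X)
    \<comment> \<open>This is the condition for S to map u to a multiple of itself. It follows from
      \<open>a * d = b * c\<close> and the two normalizations.\<close>
    have "b\<^sup>2 * x = d\<^sup>2 * y"
    proof -
      have "b\<^sup>2 * x * (a * c * d) = b * (b * c) * d * (a * x)" by (simp add: power2_eq_square)
      also have "\<dots> = (a * b * x) * d * (a * d)" using assms by (simp add: ac_simps)
      also have "\<dots> = (c * d * y) * d * (a * d)" by (simp add: x y)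
      finally have "b\<^sup>2 * x * (a * c * d) = d\<^sup>2 * y * (a * c * d)"
        by (simp add: power2_eq_square ac_simps)
      then show ?thesis using nz by simp
    qed
    then have "b * (b * y * (x^3 * r)) = b * (x * d * (y^3 * q))"
      using h by algebra
    then show ?thesis using nz by (simp add: H_def X kronecker_S_nf)
  qed
  have HT: "kronecker (T_nf a b x) (T_nf c d y) *v X \<in> H" if "X \<in> H" for X
  proof -
    obtain p q r s where X: "X = vec4 p q r s" by (rule vec4_cases)
    have h: "b * y * q = x * d * r" using that by (simp add: H_def X)
    have "b * y * (a*d*q + x*d * s) = x * d * (b*c*r + b*y * s)"
      using h assms by algebra
    then show ?thesis by (simp add: H_def X kronecker_T_nf)
  qed
  have WI: "g *v X \<in> W" if "g ** K = K ** h" "\<And>X. X \<in> H \<Longrightarrow> h *v X \<in> H" "X \<in> W" for g h X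
  proof -
    have "L ** g = h ** L" using KL that(1) by (metis matrix_mul_assoc matrix_mul_lid matrix_mul_rid)
    then have "L *v (g *v X) = h *v (L *v X)" by (simp add: matrix_vector_mul_assoc)
    then show ?thesis using that(2,3) by (simp add: W_def)
  qed
  have "W = {0} \<or> W = UNIV"
    using irreducible_repD[OF is_rep_tensor[OF reps(1,3)] irr \<open>vec.subspace W\<close>] WI S HS T HT by blast
  moreover have "X \<in> H \<longleftrightarrow> K *v X \<in> W" for X
    by (simp add: W_def matrix_vector_mul_assoc KL)
  \<comment> \<open>The two vectors witness that \<open>H\<close> is neither zero nor the whole
    space.\<close>
  moreover have "vec4 1 0 0 0 \<in> H" "vec4 0 1 0 0 \<notin> H" using nz by (auto simp: H_def)
  ultimately have "K *v vec4 1 0 0 0 = 0" by auto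
  moreover
    have LKX: "L *v (K *v X) = X" for X by (simp add: matrix_vector_mul_assoc KL)
  ultimately have "vec4 1 0 0 (0::complex) = 0"
    by (metis LKX matrix_vector_mult_0_right)
  then show False by (simp add: vec4_simps)
qed

text \<open>In normal form the given eigenvector is a multiple of \<open>vec4 1 0 0 0\<close> by
  \<open>tensor_nf_eigenvector\<close>, so \<open>tensor_nf_generated\<close> applies.\<close>

lemma generated:
  assumes W: "vec.subspace W"
    and S: "\<And>w. w \<in> W \<Longrightarrow> tensor_rep \<alpha> \<beta> S_mat *v w \<in> W"
    and T: "\<And>w. w \<in> W \<Longrightarrow> tensor_rep \<alpha> \<beta> T_mat *v w \<in> W"
    and ne: "a * d \<noteq> b * c" "a * c \<noteq> b * d"
    and X: "X \<in> W" "X \<noteq> 0" "tensor_rep \<alpha> \<beta> T_mat *v X = (a * c) *s X"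
  shows "W = UNIV"
proof -
  obtain K L x y where KL: "K ** L = mat 1" "L ** K = mat 1"
    and KS: "tensor_rep \<alpha> \<beta> S_mat ** K = K ** kronecker (S_nf x) (S_nf y)"
    and KT: "tensor_rep \<alpha> \<beta> T_mat ** K = K ** kronecker (T_nf a b x) (T_nf c d y)"
    and x: "a * b * x = 1" and y: "c * d * y = 1"
    by (rule tensor_normal_form[OF reps eigs])
  define V where "V = {X. K *v X \<in> W}"
  have KLX: "K *v (L *v X) = X" for X by (simp add: matrix_vector_mul_assoc KL)
    have LKX: "L *v (K *v X) = X" for X by (simp add: matrix_vector_mul_assoc KL)
  have V: "vec.subspace V"
    using W by (auto simp: V_def vec.subspace_def matrix_vector_right_distrib vector_scalar_commute)
  have VS: "kronecker (S_nf x) (S_nf y) *v X \<in> V" if "X \<in> V" for X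
    using that S[of "K *v X"] by (simp add: V_def matrix_vector_mul_assoc KS)
  have VT: "kronecker (T_nf a b x) (T_nf c d y) *v X \<in> V" if "X \<in> V" for X
    using that T[of "K *v X"] by (simp add: V_def matrix_vector_mul_assoc KT)
  define Y where "Y = L *v X"
  have "Y \<noteq> 0" using X(2) KLX[of X] by (auto simp: Y_def)
  have "K *v (kronecker (T_nf a b x) (T_nf c d y) *v Y) = K *v ((a * c) *s Y)"
  proof -
    have "K *v (kronecker (T_nf a b x) (T_nf c d y) *v Y) = tensor_rep \<alpha> \<beta> T_mat *v (K *v Y)"
      by (simp add: matrix_vector_mul_assoc KT)
    then show ?thesis by (simp add: Y_def KLX X(3) vector_scalar_commute)
  qed
  then have "kronecker (T_nf a b x) (T_nf c d y) *v Y = (a * c) *s Y"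
    by (metis LKX)
  then obtain k where k: "k \<noteq> 0" "Y = vec4 k 0 0 0"
    by (rule tensor_nf_eigenvector[OF _ \<open>Y \<noteq> 0\<close> x y ne])
  have "Y \<in> V" using X(1) by (simp add: V_def Y_def KLX)
  then have "(1 / k) *s Y \<in> V" by (intro vec.subspace_scale[OF V])
  then have "vec4 1 0 0 0 \<in> V" using k by (simp add: vec4_simps)
  then have "V = UNIV" using tensor_nf_generated[OF V VS VT x y ne(1)] by blast
  then have "K *v (L *v X) \<in> W" for X by (auto simp: V_def)
  then show ?thesis by (auto simp: KLX)
qed

lemma irreducible:
  assumes ne: "a * d \<noteq> b * c" "a * c \<noteq> b * d"
  shows "irreducible_rep SL2Z (tensor_rep \<alpha> \<beta>)"
  unfolding irreducible_rep_def
proof (intro allI impI)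
  fix W assume "vec.subspace W \<and> (\<forall>g\<in>carrier SL2Z. \<forall>w\<in>W. tensor_rep \<alpha> \<beta> g *v w \<in> W)"
  then have W: "vec.subspace W" and S: "\<And>w. w \<in> W \<Longrightarrow> tensor_rep \<alpha> \<beta> S_mat *v w \<in> W"
    and T: "\<And>w. w \<in> W \<Longrightarrow> tensor_rep \<alpha> \<beta> T_mat *v w \<in> W"
    using S_mat_in_SL2Z T_mat_in_SL2Z by auto
  show "W = {0} \<or> W = UNIV"
  proof (cases "W = {0}")
    case False
    obtain K L x y where KL: "K ** L = mat 1" "L ** K = mat 1"
      and KT: "tensor_rep \<alpha> \<beta> T_mat ** K = K ** kronecker (T_nf a b x) (T_nf c d y)"
      by (rule tensor_normal_form[OF reps eigs])
    define V where "V = {X. K *v X \<in> W}"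
    have KLX: "K *v (L *v X) = X" for X by (simp add: matrix_vector_mul_assoc KL)
    have LKX: "L *v (K *v X) = X" for X by (simp add: matrix_vector_mul_assoc KL)
    have V: "vec.subspace V"
      using W by (auto simp: V_def vec.subspace_def matrix_vector_right_distrib vector_scalar_commute)
    have VT: "kronecker (T_nf a b x) (T_nf c d y) *v X \<in> V" if "X \<in> V" for X
      using that T[of "K *v X"] by (simp add: V_def matrix_vector_mul_assoc KT)
    obtain w where "w \<in> W" "w \<noteq> 0" using False vec.subspace_0[OF W] by auto
    then have "L *v w \<in> V" "L *v w \<noteq> 0" using KLX[of w] by (auto simp: V_def)
    then have "V \<noteq> {0}" by auto
    then obtain Y z where Y: "Y \<in> V" "Y \<noteq> 0"
      "kronecker (T_nf a b x) (T_nf c d y) *v Y = z *s Y" "z \<in> {a * c, a * d, b * c, b * d}"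
      by (rule tensor_nf_ex_eigenvector[OF V _ VT])
    have KY: "K *v Y \<in> W" using Y(1) by (simp add: V_def)
    have "K *v Y \<noteq> 0" using Y(2)
      by (metis LKX matrix_vector_mult_0_right)
    moreover have "tensor_rep \<alpha> \<beta> T_mat *v (K *v Y) = z *s (K *v Y)"
      by (simp add: matrix_vector_mul_assoc KT) 
        (simp add: Y(3) vector_scalar_commute flip: matrix_vector_mul_assoc)
    \<comment> \<open>Exchanging \<open>a, b\<close> or \<open>c, d\<close> only permutes the two
      inequalities, and each possible \<open>z\<close> is the product of the first eigenvalues in
      one of the four orderings.\<close>
    moreover have ne': "b * c \<noteq> a * d" "b * d \<noteq> a * c" using ne by auto
    ultimately have "W = UNIV"
      using Y(4) generated[OF W S T ne KY] tensor_2.generated[OF swap_left W S T ne'(2,1) KY]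
        tensor_2.generated[OF swap_right W S T ne(2,1) KY]
        tensor_2.generated[OF tensor_2.swap_right[OF swap_left] W S T ne' KY]
      by auto
    then show ?thesis ..
  qed simp
qed

end

section \<open>Irreducibility of the factors\<close>

text \<open>An invariant \<open>W\<close> for \<alpha> yields the invariant subspace W tensor C^m,
  encoded as the vectors \<open>X\<close> with all columns in \<open>W\<close>.\<close>

lemma irreducible_tensor_left:
  fixes \<alpha> :: "'g \<Rightarrow> complex^'n^'n" and \<beta> :: "'g \<Rightarrow> complex^'m^'m"
  assumes irr: "irreducible_rep G (tensor_rep \<alpha> \<beta>)"
  shows "irreducible_rep G \<alpha>"
  unfolding irreducible_rep_def
proof (intro allI impI)
  fix W assume "vec.subspace W \<and> (\<forall>g\<in>carrier G. \<forall>w\<in>W. \<alpha> g *v w \<in> W)"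
  then have W: "vec.subspace W" and inv: "\<And>g w. g \<in> carrier G \<Longrightarrow> w \<in> W \<Longrightarrow> \<alpha> g *v w \<in> W" by auto
  define col :: "complex^('n \<times> 'm) \<Rightarrow> 'm \<Rightarrow> complex^'n" where "col X j = (\<chi> i. X $ (i, j))" for X j
  define V where "V = {X. \<forall>j. col X j \<in> W}"
  have col_simps: "col (X + Y) j = col X j + col Y j" "col (k *s X) j = k *s col X j" "col 0 j = 0" for X Y k j
    by (auto simp: col_def vec_eq_iff)
  \<comment> \<open>\<open>A\<close> acts on each column and \<open>B\<close> only mixes columns
    linearly.\<close>
  have col_kron: "col (kronecker A B *v X) j = (\<Sum>l\<in>UNIV. B $ j $ l *s (A *v col X l))" for A B X j
    by (simp add: col_def vec_eq_iff kronecker_def matrix_vector_mult_def sum_distrib_left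
        sum.cartesian_product' mult_ac flip: UNIV_Times_UNIV)
      (subst sum.swap, simp)
  have "vec.subspace V"
    using W by (auto simp: V_def vec.subspace_def col_simps)
  moreover have "\<forall>g\<in>carrier G. \<forall>w\<in>V. tensor_rep \<alpha> \<beta> g *v w \<in> V"
    by (auto simp: V_def tensor_rep_def col_kron intro!: vec.subspace_sum[OF W] vec.subspace_scale[OF W] inv)
  ultimately have "V = {0} \<or> V = UNIV" using irr by (auto simp: irreducible_rep_def)
  \<comment> \<open>\<open>ext w\<close> is w tensor (1,...,1); through it, \<open>W\<close>
    inherits from \<open>V\<close> being zero or everything.\<close>
  moreover define ext :: "complex^'n \<Rightarrow> complex^('n \<times> 'm)" where "ext w = (\<chi> p. w $ fst p)" for w
  have ext: "ext w \<in> V \<longleftrightarrow> w \<in> W" "ext w = 0 \<longleftrightarrow> w = 0" for w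
    by (auto simp: V_def ext_def col_def vec_eq_iff)
  ultimately have "W \<subseteq> {0} \<or> W = UNIV"
    by (metis UNIV_I UNIV_eq_I singleton_iff subsetI)
  then show "W = {0} \<or> W = UNIV" using vec.subspace_0[OF W] by auto
qed

text \<open>The mirror image: C^n tensor W, read off by rows.\<close>

lemma irreducible_tensor_right:
  fixes \<alpha> :: "'g \<Rightarrow> complex^'n^'n" and \<beta> :: "'g \<Rightarrow> complex^'m^'m"
  assumes irr: "irreducible_rep G (tensor_rep \<alpha> \<beta>)"
  shows "irreducible_rep G \<beta>"
  unfolding irreducible_rep_def
proof (intro allI impI)
  fix W assume "vec.subspace W \<and> (\<forall>g\<in>carrier G. \<forall>w\<in>W. \<beta> g *v w \<in> W)"
  then have W: "vec.subspace W" and inv: "\<And>g w. g \<in> carrier G \<Longrightarrow> w \<in> W \<Longrightarrow> \<beta> g *v w \<in> W" by auto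
  define row :: "complex^('n \<times> 'm) \<Rightarrow> 'n \<Rightarrow> complex^'m" where "row X i = (\<chi> j. X $ (i, j))" for X i
  define V where "V = {X. \<forall>i. row X i \<in> W}"
  have row_simps: "row (X + Y) i = row X i + row Y i" "row (k *s X) i = k *s row X i" "row 0 i = 0" for X Y k i
    by (auto simp: row_def vec_eq_iff)
  have row_kron: "row (kronecker A B *v X) i = (\<Sum>l\<in>UNIV. A $ i $ l *s (B *v row X l))" for A B X i
    by (simp add: row_def vec_eq_iff kronecker_def matrix_vector_mult_def sum_distrib_left
        sum.cartesian_product' mult_ac flip: UNIV_Times_UNIV)
  have "vec.subspace V"
    using W by (auto simp: V_def vec.subspace_def row_simps)
  moreover have "\<forall>g\<in>carrier G. \<forall>w\<in>V. tensor_rep \<alpha> \<beta> g *v w \<in> V"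
    by (auto simp: V_def tensor_rep_def row_kron intro!: vec.subspace_sum[OF W] vec.subspace_scale[OF W] inv)
  ultimately have "V = {0} \<or> V = UNIV" using irr by (auto simp: irreducible_rep_def)
  moreover define ext :: "complex^'m \<Rightarrow> complex^('n \<times> 'm)" where "ext w = (\<chi> p. w $ snd p)" for w
  have ext: "ext w \<in> V \<longleftrightarrow> w \<in> W" "ext w = 0 \<longleftrightarrow> w = 0" for w
    by (auto simp: V_def ext_def row_def vec_eq_iff)
  ultimately have "W \<subseteq> {0} \<or> W = UNIV"
    by (metis UNIV_I UNIV_eq_I singleton_iff subsetI)
  then show "W = {0} \<or> W = UNIV" using vec.subspace_0[OF W] by auto
qed

section \<open>Translation of the eigenvalue criterion into T-regularity\<close>

theorem theorem22:
  fixes \<alpha> \<beta> :: "int^2^2 \<Rightarrow> complex^2^2"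
  assumes "is_rep SL2Z \<alpha>" and "is_rep SL2Z \<beta>"
  shows "irreducible_rep SL2Z (tensor_rep \<alpha> \<beta>) \<longleftrightarrow>
    irreducible_rep SL2Z \<alpha> \<and> irreducible_rep SL2Z \<beta> \<and>
    ((T_regular \<alpha> \<and> \<not> T_regular \<beta> \<or> \<not> T_regular \<alpha> \<and> T_regular \<beta>) \<or>
     (T_regular \<alpha> \<and> T_regular \<beta> \<and> T_regular (tensor_rep \<alpha> \<beta>)))"
proof (cases "irreducible_rep SL2Z \<alpha> \<and> irreducible_rep SL2Z \<beta>")
  case False
  then show ?thesis using irreducible_tensor_left irreducible_tensor_right by metis
next
  case True
  obtain a b where ab: "trace (\<alpha> T_mat) = a + b" "det (\<alpha> T_mat) = a * b" by (rule ex_eigenvalues_2)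
  obtain c d where cd: "trace (\<beta> T_mat) = c + d" "det (\<beta> T_mat) = c * d" by (rule ex_eigenvalues_2)
  interpret tensor_2 \<alpha> \<beta> a b c d
    using assms True ab cd by unfold_locales auto
  have "det (\<alpha> T_mat) \<noteq> 0" "det (\<beta> T_mat) \<noteq> 0"
    using is_rep_invertible assms T_mat_in_SL2Z by (auto simp flip: invertible_det_nz)
  then have nz: "a \<noteq> 0" "b \<noteq> 0" "c \<noteq> 0" "d \<noteq> 0" using ab cd by auto
  have reg: "T_regular \<alpha> \<longleftrightarrow> a \<noteq> b" "T_regular \<beta> \<longleftrightarrow> c \<noteq> d"
    by (simp_all add: T_regular_eq_2 eigenvalues_2 ab cd)
  have "T_regular (tensor_rep \<alpha> \<beta>) \<longleftrightarrow> distinct [a * c, a * d, b * c, b * d]"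
    by (rule T_regular_eq_4) (simp add: tensor_rep_def eigenvalues_kronecker_2[OF ab cd])
  \<comment> \<open>Of the six comparisons, four reduce to \<open>a = b\<close> or
    \<open>c = d\<close> by cancelling a nonzero eigenvalue.\<close>
  then have reg_tensor: "T_regular (tensor_rep \<alpha> \<beta>) \<longleftrightarrow> a \<noteq> b \<and> c \<noteq> d \<and> a * d \<noteq> b * c \<and> a * c \<noteq> b * d"
    using nz by auto
  have "irreducible_rep SL2Z (tensor_rep \<alpha> \<beta>) \<longleftrightarrow> a * d \<noteq> b * c \<and> a * c \<noteq> b * d"
    using irreducible reducible tensor_2.reducible[OF swap_right] by blast
  \<comment> \<open>If exactly one factor is regular, both inequalities hold by cancellation; if
    neither is, \<open>a * d = b * c\<close>; if both are, the inequalities amount to regularity of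
    the tensor product.\<close>
  then show ?thesis using True nz unfolding reg reg_tensor by auto
qed

end
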